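(* Let $L \ge 3$ be an odd number. For $N \ge 2$ let $T^{M,L}_N$ denote the period of the M-type Grover walk with $L$ states on the cycle graph $C_N$. Then $T^{M,L}_L = 2L$, and for every integer $N \ge 2$ such that $N$ has a factor $n \ge 2$ which is coprime to $L$, one has $T^{M,L}_N = \infty$.
   Context: Let $L \ge 3$ be odd, $m = (L-1)/2$, and $N \ge 2$. The cycle graph $C_N$ has vertex set $\{0,1,\dots,N-1\}$, with vertices identified modulo $N$. Let $\mathcal{H}_P$ be the complex Hilbert space with orthonormal basis $\{|k\rangle : k \in \{0,\dots,N-1\}\}$ (labels read modulo $N$), and let $\mathcal{H}_C$ be the complex Hilbert space with ordered orthonormal basis $(|\leftarrow m\rangle, \dots, |\leftarrow 1\rangle, |\cdot\rangle, |1\rightarrow\rangle, \dots, |m\rightarrow\rangle)$. Put $\mathcal{H} = \mathcal{H}_P \otimes \mathcal{H}_C$. The shift operator $S$ on $\mathcal{H}$ is the linear operator with $S(|k\rangle\otimes|\leftarrow j\rangle) = |k-j\rangle\otimes|\leftarrow j\rangle$ and $S(|k\rangle\otimes|j\rightarrow\rangle) = |k+j\rangle\otimes|j\rightarrow\rangle$ for $j=1,\dots,m$, and $S(|k\rangle\otimes|\cdot\rangle) = |k\rangle\otimes|\cdot\rangle$, where positions are read modulo $N$. The M-type local coin operator is the operator on $\mathcal{H}_C$ whose matrix $A^{M,L}$ in the ordered basis above is the $L\times L$ matrix with every diagonal entry equal to $-(2m-1)/L$ and every off-diagonal entry equal to $2/L$. The coin operator is $C = \sum_{k=0}^{N-1}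 |k\rangle\langle k| \otimes A^{M,L}$. The M-type Grover walk with $L$ states on $C_N$ is the quantum walk with time-evolution operator $U^{M,L}_N = SC$. Its period is $T^{M,L}_N = \inf\{ n \ge 1 : (U^{M,L}_N)^n = I\}$, defined to be $\infty$ if this set is empty. *)

theory Defs
  imports "Jordan_Normal_Form.Matrix" "HOL-Library.Extended_Nat" Complex_Main
begin

text \<open>
  Operators on the finite-dimensional Hilbert spaces are represented by their matrices in the
  given orthonormal bases. The tensor product of a space of dimension \<open>a\<close> with one of
  dimension \<open>b\<close> has dimension \<open>a * b\<close>; the basis vector number \<open>k * b + c\<close> is the tensor
  product of the basis vectors number \<open>k\<close> and \<open>c\<close>.
\<close>

definition tensor_vec :: "complex vec \<Rightarrow> complex vec \<Rightarrow> complex vec" where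
  "tensor_vec u v =
     vec (dim_vec u * dim_vec v) (\<lambda>i. u $ (i div dim_vec v) * v $ (i mod dim_vec v))"

definition tensor_mat :: "complex mat \<Rightarrow> complex mat \<Rightarrow> complex mat" where
  "tensor_mat A B =
     mat (dim_row A * dim_row B) (dim_col A * dim_col B)
       (\<lambda>(i, j). A $$ (i div dim_row B, j div dim_col B) * B $$ (i mod dim_row B, j mod dim_col B))"

definition pos_ket :: "nat \<Rightarrow> int \<Rightarrow> complex vec" where
  "pos_ket N k = unit_vec N (nat (k mod int N))"

definition half :: "nat \<Rightarrow> nat" where
  "half L = (L - 1) div 2"

text \<open>
  A coin state is labelled by its displacement \<open>d\<close> with \<open>\<bar>d\<bar> \<le> half L\<close>: the state
  \<open>|\<leftarrow> j\<rangle>\<close> has \<open>d = - j\<close>, the state \<open>|\<cdot>\<rangle>\<close> has \<open>d = 0\<close>, and \<open>|j \<rightarrow>\<rangle>\<close> has \<open>d = j\<close>.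
  In the ordered coin basis this is the vector number \<open>half L + d\<close>, counting from 0.
\<close>

definition coin_ket :: "nat \<Rightarrow> int \<Rightarrow> complex vec" where
  "coin_ket L d = unit_vec L (nat (int (half L) + d))"

definition displacement :: "nat \<Rightarrow> nat \<Rightarrow> int" where
  "displacement L c = int c - int (half L)"

text \<open>The columns are the images of the basis vectors; see \<open>shift_op_ket\<close> below.\<close>

definition shift_op :: "nat \<Rightarrow> nat \<Rightarrow> complex mat" where
  "shift_op N L = mat_of_cols (N * L)
     (map (\<lambda>j. let k = j div L; d = displacement L (j mod L)
               in tensor_vec (pos_ket N (int k + d)) (coin_ket L d))
       [0..<N * L])"

definition coin_M :: "nat \<Rightarrow> complex mat" where
  "coin_M L = mat L L (\<lambda>(i, j).
     if i = j then - (2 * of_nat (half L) - 1) / of_nat L else 2 / of_nat L)"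

definition pos_proj :: "nat \<Rightarrow> nat \<Rightarrow> complex mat" where
  "pos_proj N k = mat N N (\<lambda>(i, j). if i = k \<and> j = k then 1 else 0)"

definition coin_op :: "nat \<Rightarrow> nat \<Rightarrow> complex mat" where
  "coin_op N L =
     finsum (ring_mat TYPE(complex) (N * L) ()) (\<lambda>k. tensor_mat (pos_proj N k) (coin_M L)) {..<N}"

definition grover_walk_M :: "nat \<Rightarrow> nat \<Rightarrow> complex mat" where
  "grover_walk_M N L = shift_op N L * coin_op N L"

text \<open>In \<^typ>\<open>enat\<close> the infimum of the empty set is \<open>\<infinity>\<close>.\<close>

definition period_M :: "nat \<Rightarrow> nat \<Rightarrow> enat" where
  "period_M N L = Inf (enat ` {n. n \<ge> 1 \<and> grover_walk_M N L ^\<^sub>m n = 1\<^sub>m (N * L)})"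

lemma index_less:
  fixes k c N L :: nat
  assumes "k < N" "c < L"
  shows "k * L + c < N * L"
proof -
  have "k * L + c < k * L + L" using assms by simp
  also have "\<dots> = Suc k * L" by simp
  also have "\<dots> \<le> N * L" using assms by (intro mult_le_mono1) simp
  finally show ?thesis .
qed

lemma tensor_unit_vec:
  assumes "k < N" "c < L"
  shows "tensor_vec (unit_vec N k) (unit_vec L c) = unit_vec (N * L) (k * L + c)"
proof (rule eq_vecI)
  fix i assume "i < dim_vec (unit_vec (N * L) (k * L + c) :: complex vec)"
  then have i: "i < N * L" by simp
  then have L: "L > 0" by (cases L) auto
  have "i div L < N" "i mod L < L" using i L by (auto simp: less_mult_imp_div_less)
  moreover have "i = k * L + c \<longleftrightarrow> i div L = k \<and> i mod L = c"
    using assms L div_mult_mod_eq[of i L] by auto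
  ultimately show "tensor_vec (unit_vec N k) (unit_vec L c) $ i = unit_vec (N * L) (k * L + c) $ i"
    using i assms index_less[OF assms] by (auto simp: tensor_vec_def unit_vec_def)
qed (simp add: tensor_vec_def)

lemma shift_op_ket:
  assumes "odd L" "N > 0" "\<bar>d\<bar> \<le> int (half L)"
  shows "shift_op N L *\<^sub>v tensor_vec (pos_ket N k) (coin_ket L d)
         = tensor_vec (pos_ket N (k + d)) (coin_ket L d)"
proof -
  define a c where "a = nat (k mod int N)" and "c = nat (int (half L) + d)"
  have a: "a < N" "int a = k mod int N" using assms(2) by (auto simp: a_def nat_less_iff)
  have c: "c < L" "displacement L c = d"
    using assms(1,3) by (auto simp: c_def half_def displacement_def nat_less_iff elim!: oddE)
  have lt: "a * L + c < N * L" using a c by (intro index_less)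
  have ket: "tensor_vec (pos_ket N k) (coin_ket L d) = unit_vec (N * L) (a * L + c)"
    using tensor_unit_vec[OF a(1) c(1)] by (simp add: pos_ket_def coin_ket_def a_def c_def)
  have carr: "shift_op N L \<in> carrier_mat (N * L) (N * L)"
    by (simp add: shift_op_def mat_of_cols_def)
  have dim: "tensor_vec (pos_ket N x) (coin_ket L y) \<in> carrier_vec (N * L)" for x y
    by (rule carrier_vecI) (simp add: tensor_vec_def pos_ket_def coin_ket_def)
  have "shift_op N L *\<^sub>v unit_vec (N * L) (a * L + c) = col (shift_op N L) (a * L + c)"
  proof (rule eq_vecI)
    fix i assume "i < dim_vec (col (shift_op N L) (a * L + c))"
    then have i: "i < dim_row (shift_op N L)" by simp
    show "(shift_op N L *\<^sub>v unit_vec (N * L) (a * L + c)) $ i = col (shift_op N L) (a * L + c) $ i"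
      using i lt carr scalar_prod_right_unit[OF lt, of "row (shift_op N L) i"]
      by (simp del: scalar_prod_right_unit)
  qed simp
  also have "\<dots> = tensor_vec (pos_ket N (int a + d)) (coin_ket L d)"
  proof -
    have "(a * L + c) div L = a" "(a * L + c) mod L = c" using c(1) by auto
    then show ?thesis
      unfolding shift_op_def using lt c(2) dim by (subst col_mat_of_cols) (simp_all add: Let_def)
  qed
  also have "pos_ket N (int a + d) = pos_ket N (k + d)"
    unfolding pos_ket_def a(2) by (simp add: mod_add_left_eq)
  finally show ?thesis using ket by simp
qed

lemma coin_op_eq: "coin_op N L = tensor_mat (1\<^sub>m N) (coin_M L)"
proof -
  let ?R = "ring_mat TYPE(complex) (N * L) ()"
  let ?f = "\<lambda>k. tensor_mat (pos_proj N k) (coin_M L)"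
  interpret R: ring ?R by (rule ring_mat)
  have carr: "?f k \<in> carrier_mat (N * L) (N * L)" for k
    by (rule carrier_matI) (simp_all add: tensor_mat_def pos_proj_def coin_M_def)
  then have f: "?f \<in> A \<rightarrow> carrier ?R" for A by (simp add: ring_mat_simps)
  have sum: "finsum ?R ?f A = mat (N * L) (N * L) (\<lambda>(i, j). \<Sum>k\<in>A. ?f k $$ (i, j))"
    if "finite A" for A
    using that
  proof (induction A rule: finite_induct)
    case empty
    show ?case by (simp add: ring_mat_simps zero_mat_def)
  next
    case (insert k A)
    have "finsum ?R ?f (insert k A) = ?f k + finsum ?R ?f A"
      using R.finsum_insert[OF insert.hyps f] carr[of k] by (simp add: ring_mat_simps)
    also have "\<dots> = mat (N * L) (N * L) (\<lambda>(i, j). \<Sum>k\<in>insert k A. ?f k $$ (i, j))"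
      unfolding insert.IH using carr[of k] insert.hyps by (intro eq_matI) auto
    finally show ?case .
  qed
  show ?thesis
    unfolding coin_op_def sum[OF finite_lessThan]
  proof (rule eq_matI)
    fix i j
    assume "i < dim_row (tensor_mat (1\<^sub>m N) (coin_M L))"
      and "j < dim_col (tensor_mat (1\<^sub>m N) (coin_M L))"
    then have ij: "i < N * L" "j < N * L" by (simp_all add: tensor_mat_def coin_M_def)
    then have L: "i div L < N" "j div L < N" by (simp_all add: less_mult_imp_div_less)
    have "?f k $$ (i, j) = (if k = i div L then
            if i div L = j div L then coin_M L $$ (i mod L, j mod L) else 0 else 0)" for k
      using ij L by (auto simp: tensor_mat_def pos_proj_def coin_M_def)
    then show "mat (N * L) (N * L) (\<lambda>(i, j). \<Sum>k<N. ?f k $$ (i, j)) $$ (i, j)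
               = tensor_mat (1\<^sub>m N) (coin_M L) $$ (i, j)"
      using ij L by (simp add: tensor_mat_def coin_M_def)
  qed (simp_all add: tensor_mat_def coin_M_def)
qed

end

(* For N = L the walk permutes the plane waves (k, l) up to sign: coin and shift send (k, l) to
   \<plusminus>(k, l - k), the sign being + exactly when L divides l. Going twice through the
   residues l, l - k, l - 2k, ... makes every sign occur an even number of times, hence U^(2L) = 1;
   the orbits of (0, 1) and (1, 0) show that 2L divides every exponent n with U^n = 1.

   For the second part L * U is an integer operator, congruent modulo L to 2 S (1 \<otimes> J) with J
   the all-ones matrix. If U^t = 1, then (L * U)^t vanishes modulo L, and as L is odd so does H^t on
   N-periodic integer functions, where H is the sum over a window of length L. If n is coprime
   to L, then an n-periodic g with H g = 0 is L-periodic, hence constant modulo L; if moreover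
   g = H h, summing over a period gives n g = L (h(0) + ... + h(n-1)) = 0, so g = 0. Therefore
   H^t f = 0 forces H f = 0, and then f is constant modulo L, which fails for the indicator of the
   multiples of n. *)

theory Submission
  imports Defs "HOL-Library.Periodic_Fun" "HOL-Number_Theory.Cong"
begin

section \<open>The walk as a recursion on periodic amplitude functions\<close>

text \<open>Positions range over all integers, so that a shift is plain subtraction; wrapping around
  the cycle is expressed by requiring \<open>\<phi>\<close> to have period \<open>int N\<close> in
  its first argument.\<close>

definition amplitude_vec :: "nat \<Rightarrow> nat \<Rightarrow> (int \<Rightarrow> nat \<Rightarrow> complex) \<Rightarrow> complex vec" where
  "amplitude_vec N L \<phi> = vec (N * L) (\<lambda>i. \<phi> (int (i div L)) (i mod L))"

text \<open>The coin is \<open>2 / L\<close> times the all-ones matrix minus the identity. The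
  amplitude found at \<open>x\<close> in coin state \<open>c\<close> comes from
  \<open>x - displacement L c\<close>, where the coin has acted first.\<close>

definition walk_step :: "nat \<Rightarrow> (int \<Rightarrow> nat \<Rightarrow> complex) \<Rightarrow> int \<Rightarrow> nat \<Rightarrow> complex" where
  "walk_step L \<phi> x c =
     2 / of_nat L * (\<Sum>c'<L. \<phi> (x - displacement L c) c') - \<phi> (x - displacement L c) c"

lemma periodic_add_mult:
  fixes f :: "int \<Rightarrow> 'a"
  assumes "\<And>x. f (x + p) = f x"
  shows "f (x + k * p) = f x"
proof -
  interpret periodic_fun_simple f p by standard (rule assms)
  show ?thesis using plus_of_int[of x k] by simp
qed

lemma periodic_mod:
  fixes f :: "int \<Rightarrow> 'a"
  assumes "\<And>x. f (x + p) = f x"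
  shows "f (x mod p) = f x"
  using periodic_add_mult[of f p "x mod p" "x div p", OF assms] by simp

lemma sum_lessThan_mult:
  fixes f :: "nat \<Rightarrow> 'a::comm_monoid_add"
  shows "(\<Sum>i<n * k. f i) = (\<Sum>a<n. \<Sum>b<k. f (a * k + b))"
proof -
  have "sum f {a * k..<a * k + k} = (\<Sum>b<k. f (a * k + b))" for a
    by (subst sum.atLeastLessThan_shift_0) (simp add: lessThan_atLeast0)
  then show ?thesis by (simp flip: sum.nat_group)
qed

lemma shift_op_amplitude_vec:
  assumes "N > 0" and per: "\<And>x c. \<phi> (x + int N) c = \<phi> x c"
  shows "shift_op N L *\<^sub>v amplitude_vec N L \<phi>
         = amplitude_vec N L (\<lambda>x c. \<phi> (x - displacement L c) c)"
proof (rule eq_vecI)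
  have carr: "shift_op N L \<in> carrier_mat (N * L) (N * L)"
    by (simp add: shift_op_def mat_of_cols_def)
  show "dim_vec (shift_op N L *\<^sub>v amplitude_vec N L \<phi>)
        = dim_vec (amplitude_vec N L (\<lambda>x c. \<phi> (x - displacement L c) c))"
    using carr by (simp add: amplitude_vec_def)
  fix i assume "i < dim_vec (amplitude_vec N L (\<lambda>x c. \<phi> (x - displacement L c) c))"
  then have i: "i < N * L" by (simp add: amplitude_vec_def)
  then have "L > 0" by (cases L) auto
  define k c where "k = i div L" and "c = i mod L"
  have kc: "k < N" "c < L" "i = k * L + c"
    using i \<open>L > 0\<close> by (auto simp: k_def c_def less_mult_imp_div_less)
  \<comment> \<open>The one position from which coin state \<open>c\<close> is carried to
    \<open>k\<close>: row \<open>i\<close> of the shift has its only nonzero entry in column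
    \<open>a * L + c\<close>.\<close>
  define a where "a = nat ((int k - displacement L c) mod int N)"
  have a: "a < N" "int a = (int k - displacement L c) mod int N"
    using assms(1) by (auto simp: a_def nat_less_iff)
  have g: "a * L + c < N * L" using a(1) kc(2) by (rule index_less)
  have entry: "shift_op N L $$ (i, j) = (if j = a * L + c then 1 else 0)" if j: "j < N * L" for j
  proof -
    define b e where "b = j div L" and "e = j mod L"
    have be: "b < N" "e < L" "j = b * L + e"
      using j \<open>L > 0\<close> by (auto simp: b_def e_def less_mult_imp_div_less)
    define r where "r = nat ((int b + displacement L e) mod int N)"
    have r: "r < N" "int r = (int b + displacement L e) mod int N"
      using assms(1) by (auto simp: r_def nat_less_iff)
    have "shift_op N L $$ (i, j)
          = tensor_vec (pos_ket N (int b + displacement L e)) (coin_ket L (displacement L e)) $ i"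
      using i j by (simp add: shift_op_def mat_of_cols_def Let_def b_def e_def)
    also have "\<dots> = unit_vec (N * L) (r * L + e) $ i"
      using tensor_unit_vec[OF r(1) be(2)]
      by (simp add: pos_ket_def coin_ket_def r_def displacement_def)
    also have "\<dots> = (if i = r * L + e then 1 else 0)"
      using i index_less[OF r(1) be(2)] by (simp add: unit_vec_def)
    also have "i = r * L + e \<longleftrightarrow> k = r \<and> c = e"
      unfolding k_def c_def using be(2) div_mult_mod_eq[of i L] by auto
    \<comment> \<open>Translation by a fixed displacement is a bijection modulo \<open>N\<close>;
      \<open>r\<close> is the image of \<open>b\<close>, and \<open>a\<close> is the preimage of
      \<open>k\<close>.\<close>
    also have "\<dots> \<longleftrightarrow> b = a \<and> e = c"
    proof -
      have "k = r \<longleftrightarrow> b = a" if "c = e"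
      proof
        assume "k = r"
        then have "int a = ((int b + displacement L e) mod int N - displacement L e) mod int N"
          using a(2) r(2) that by simp
        also have "\<dots> = int b" using be(1) by (simp add: mod_diff_left_eq)
        finally show "b = a" by simp
      next
        assume "b = a"
        then have "int r = ((int k - displacement L e) mod int N + displacement L e) mod int N"
          using a(2) r(2) that by simp
        also have "\<dots> = int k" using kc(1) by (simp add: mod_add_left_eq)
        finally show "k = r" by simp
      qed
      then show ?thesis by auto
    qed
    also have "\<dots> \<longleftrightarrow> j = a * L + c"
      unfolding b_def e_def using kc(2) div_mult_mod_eq[of j L] by auto
    finally show ?thesis .
  qed
  have "(shift_op N L *\<^sub>v amplitude_vec N L \<phi>) $ i
        = (\<Sum>j<N * L. shift_op N L $$ (i, j) * \<phi> (int (j div L)) (j mod L))"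
    using i carr by (simp add: amplitude_vec_def scalar_prod_def lessThan_atLeast0)
  also have "\<dots> = (\<Sum>j<N * L. if j = a * L + c then \<phi> (int (j div L)) (j mod L) else 0)"
    by (intro sum.cong) (auto simp: entry)
  also have "\<dots> = \<phi> (int a) c"
    using g kc(2) by simp
  also have "\<dots> = \<phi> (int k - displacement L c) c"
    unfolding a(2) by (rule periodic_mod) (rule per)
  finally show "(shift_op N L *\<^sub>v amplitude_vec N L \<phi>) $ i
        = amplitude_vec N L (\<lambda>x c. \<phi> (x - displacement L c) c) $ i"
    using i by (simp add: amplitude_vec_def k_def c_def)
qed

lemma coin_op_amplitude_vec:
  assumes "odd L"
  shows "coin_op N L *\<^sub>v amplitude_vec N L \<phi>
         = amplitude_vec N L (\<lambda>x c. 2 / of_nat L * (\<Sum>c'<L. \<phi> x c') - \<phi> x c)"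
proof (rule eq_vecI)
  have L: "L > 0" using assms by (cases L) auto
  \<comment> \<open>By \<open>L = 2 * half L + 1\<close> the diagonal entry is
    \<open>2 / L - 1\<close>, so all entries share the term \<open>2 / L\<close>.\<close>
  have coin: "coin_M L $$ (c, c') = 2 / of_nat L - (if c = c' then 1 else 0)"
    if "c < L" "c' < L" for c c'
  proof -
    have "of_nat L = 2 * of_nat (half L) + (1 :: complex)"
      using assms by (elim oddE) (simp add: half_def)
    then have "- (2 * of_nat (half L) - 1) = (2 - of_nat L :: complex)" by simp
    then have "- (2 * of_nat (half L) - 1) / of_nat L = 2 / of_nat L - (1 :: complex)"
      using L by (simp only: diff_divide_distrib) simp
    then show ?thesis using that by (simp only: coin_M_def index_mat split: if_splits) simp
  qed
  have carr: "coin_op N L \<in> carrier_mat (N * L) (N * L)"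
    unfolding coin_op_eq by (rule carrier_matI) (simp_all add: tensor_mat_def coin_M_def)
  show "dim_vec (coin_op N L *\<^sub>v amplitude_vec N L \<phi>) =
    dim_vec (amplitude_vec N L (\<lambda>x c. 2 / of_nat L * (\<Sum>c'<L. \<phi> x c') - \<phi> x c))"
    using carr by (simp add: amplitude_vec_def)
  fix i assume "i < dim_vec (amplitude_vec N L (\<lambda>x c. 2 / of_nat L * (\<Sum>c'<L. \<phi> x c') - \<phi> x c))"
  then have i: "i < N * L" by (simp add: amplitude_vec_def)
  define k c where "k = i div L" and "c = i mod L"
  have kc: "k < N" "c < L"
    using i L by (auto simp: k_def c_def less_mult_imp_div_less)
  have "(coin_op N L *\<^sub>v amplitude_vec N L \<phi>) $ i
        = (\<Sum>j<N * L. coin_op N L $$ (i, j) * \<phi> (int (j div L)) (j mod L))"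
    using i carr by (simp add: amplitude_vec_def scalar_prod_def lessThan_atLeast0)
  also have "\<dots> = (\<Sum>a<N. \<Sum>b<L. coin_op N L $$ (i, a * L + b) * \<phi> (int a) b)"
    by (simp add: sum_lessThan_mult)
  also have "\<dots> = (\<Sum>a<N. if a = k then \<Sum>b<L. coin_M L $$ (c, b) * \<phi> (int a) b else 0)"
  proof (intro sum.cong refl)
    fix a assume a: "a \<in> {..<N}"
    have "coin_op N L $$ (i, a * L + b) = (if a = k then coin_M L $$ (c, b) else 0)"
      if "b < L" for b
      using a that i kc index_less[of a N b L]
      by (auto simp: coin_op_eq tensor_mat_def coin_M_def k_def c_def)
    then show "(\<Sum>b<L. coin_op N L $$ (i, a * L + b) * \<phi> (int a) b)
        = (if a = k then \<Sum>b<L. coin_M L $$ (c, b) * \<phi> (int a) b else 0)"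
      by (auto intro!: sum.cong)
  qed
  also have "\<dots> = (\<Sum>b<L. coin_M L $$ (c, b) * \<phi> (int k) b)"
    using kc by simp
  also have "\<dots> = (\<Sum>b<L. 2 / of_nat L * \<phi> (int k) b - (if b = c then \<phi> (int k) b else 0))"
    using kc by (intro sum.cong) (auto simp: coin left_diff_distrib)
  also have "\<dots> = 2 / of_nat L * (\<Sum>c'<L. \<phi> (int k) c') - \<phi> (int k) c"
    using kc by (simp add: sum_subtractf sum_distrib_left)
  finally show "(coin_op N L *\<^sub>v amplitude_vec N L \<phi>) $ i
    = amplitude_vec N L (\<lambda>x c. 2 / of_nat L * (\<Sum>c'<L. \<phi> x c') - \<phi> x c) $ i"
    using i by (simp add: amplitude_vec_def k_def c_def)
qed

lemma walk_step_periodic: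
  assumes "\<And>x c. \<phi> (x + p) c = \<phi> x c"
  shows "walk_step L \<phi> (x + p) c = walk_step L \<phi> x c"
proof -
  have "\<phi> (x + p - displacement L c) c' = \<phi> (x - displacement L c) c'" for c'
    using assms[of "x - displacement L c"] by (simp add: algebra_simps)
  then show ?thesis by (simp add: walk_step_def)
qed

lemma walk_steps_periodic:
  assumes "\<And>x c. \<phi> (x + p) c = \<phi> x c"
  shows "(walk_step L ^^ n) \<phi> (x + p) c = (walk_step L ^^ n) \<phi> x c"
  by (induction n arbitrary: x c) (simp_all add: assms walk_step_periodic)

lemma grover_walk_M_carrier: "grover_walk_M N L \<in> carrier_mat (N * L) (N * L)"
  unfolding grover_walk_M_def coin_op_eq
  by (rule mult_carrier_mat[of _ _ "N * L"])
    (auto simp: shift_op_def mat_of_cols_def tensor_mat_def coin_M_def)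

lemma grover_walk_M_amplitude_vec:
  assumes "odd L" "N > 0" and per: "\<And>x c. \<phi> (x + int N) c = \<phi> x c"
  shows "grover_walk_M N L *\<^sub>v amplitude_vec N L \<phi> = amplitude_vec N L (walk_step L \<phi>)"
proof -
  have "shift_op N L \<in> carrier_mat (N * L) (N * L)"
    by (simp add: shift_op_def mat_of_cols_def)
  moreover have "coin_op N L \<in> carrier_mat (N * L) (N * L)"
    unfolding coin_op_eq by (rule carrier_matI) (simp_all add: tensor_mat_def coin_M_def)
  moreover have "amplitude_vec N L \<phi> \<in> carrier_vec (N * L)"
    by (simp add: amplitude_vec_def)
  ultimately have "grover_walk_M N L *\<^sub>v amplitude_vec N L \<phi>
      = shift_op N L *\<^sub>v (coin_op N L *\<^sub>v amplitude_vec N L \<phi>)"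
    unfolding grover_walk_M_def by (rule assoc_mult_mat_vec)
  then show ?thesis
    unfolding coin_op_amplitude_vec[OF assms(1)]
    using assms(2) by (simp add: shift_op_amplitude_vec per walk_step_def[abs_def])
qed

lemma grover_walk_M_pow_amplitude_vec:
  assumes "odd L" "N > 0" and per: "\<And>x c. \<phi> (x + int N) c = \<phi> x c"
  shows "(grover_walk_M N L ^\<^sub>m n) *\<^sub>v amplitude_vec N L \<phi>
         = amplitude_vec N L ((walk_step L ^^ n) \<phi>)"
  using per
\<comment> \<open>The matrix power splits off its rightmost factor, which acts first, so the
  induction hypothesis is applied to \<open>walk_step L \<phi>\<close>.\<close>
proof (induction n arbitrary: \<phi>)
  case 0
  then show ?case
    using grover_walk_M_carrier[of N L] by (simp add: amplitude_vec_def)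
next
  case (Suc n)
  have "(grover_walk_M N L ^\<^sub>m Suc n) *\<^sub>v amplitude_vec N L \<phi>
      = (grover_walk_M N L ^\<^sub>m n) *\<^sub>v (grover_walk_M N L *\<^sub>v amplitude_vec N L \<phi>)"
    unfolding pow_mat.simps
    by (rule assoc_mult_mat_vec[OF pow_carrier_mat[OF grover_walk_M_carrier] grover_walk_M_carrier])
      (simp add: amplitude_vec_def)
  also have "\<dots> = (grover_walk_M N L ^\<^sub>m n) *\<^sub>v amplitude_vec N L (walk_step L \<phi>)"
    using assms(1,2) Suc.prems by (simp add: grover_walk_M_amplitude_vec)
  also have "\<dots> = amplitude_vec N L ((walk_step L ^^ n) (walk_step L \<phi>))"
    by (rule Suc.IH) (rule walk_step_periodic, rule Suc.prems)
  finally show ?case by (simp add: funpow_swap1)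
qed

text \<open>Comparing entries gives the identity at the positions \<open>0\<close> to
  \<open>N - 1\<close>; periodicity of both sides carries it to every integer
  \<open>x\<close>.\<close>

lemma grover_walk_M_pow_eq_oneD:
  assumes "odd L" "N > 0" and per: "\<And>x c. \<phi> (x + int N) c = \<phi> x c"
    and one: "grover_walk_M N L ^\<^sub>m n = 1\<^sub>m (N * L)" and c: "c < L"
  shows "(walk_step L ^^ n) \<phi> x c = \<phi> x c"
proof -
  define k where "k = nat (x mod int N)"
  have k: "k < N" "int k = x mod int N"
    using assms(2) by (auto simp: k_def nat_less_iff)
  have "amplitude_vec N L ((walk_step L ^^ n) \<phi>) = amplitude_vec N L \<phi>"
    using grover_walk_M_pow_amplitude_vec[of L N \<phi> n] assms(1,2) per one
    by (simp add: amplitude_vec_def)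
  then have "amplitude_vec N L ((walk_step L ^^ n) \<phi>) $ (k * L + c)
             = amplitude_vec N L \<phi> $ (k * L + c)"
    by simp
  then have "(walk_step L ^^ n) \<phi> (x mod int N) c = \<phi> (x mod int N) c"
    using index_less[OF k(1) c] c by (simp add: amplitude_vec_def k(2)[symmetric])
  then show ?thesis
    using periodic_mod[of "\<lambda>x. (walk_step L ^^ n) \<phi> x c" "int N" x]
      periodic_mod[of "\<lambda>x. \<phi> x c" "int N" x] per
    by (simp add: walk_steps_periodic)
qed

text \<open>The columns of the power are its values on the basis vectors, so it suffices to realize
  each basis vector by a periodic function that \<open>n\<close> steps leave invariant.\<close>

lemma grover_walk_M_pow_eq_oneI:
  assumes "odd L" "N > 0"
    and unit: "\<And>a b. a < N \<Longrightarrow> b < L \<Longrightarrow> \<exists>\<phi>. (\<forall>x c. \<phi> (x + int N) c = \<phi> x c) \<and>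
      (walk_step L ^^ n) \<phi> = \<phi> \<and> amplitude_vec N L \<phi> = unit_vec (N * L) (a * L + b)"
  shows "grover_walk_M N L ^\<^sub>m n = 1\<^sub>m (N * L)"
proof (rule eq_matI)
  let ?U = "grover_walk_M N L ^\<^sub>m n"
  have carr: "?U \<in> carrier_mat (N * L) (N * L)"
    by (rule pow_carrier_mat) (rule grover_walk_M_carrier)
  then show "dim_row ?U = dim_row (1\<^sub>m (N * L))" "dim_col ?U = dim_col (1\<^sub>m (N * L))"
    by auto
  fix i j assume "i < dim_row (1\<^sub>m (N * L) :: complex mat)" "j < dim_col (1\<^sub>m (N * L) :: complex mat)"
  then have ij: "i < N * L" "j < N * L" by simp_all
  then have "L > 0" by (cases L) auto
  with ij have "j div L < N" "j mod L < L" by (simp_all add: less_mult_imp_div_less)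
  from unit[OF this] obtain \<phi> where \<phi>: "\<And>x c. \<phi> (x + int N) c = \<phi> x c"
    "(walk_step L ^^ n) \<phi> = \<phi>" "amplitude_vec N L \<phi> = unit_vec (N * L) j"
    by auto
  have "?U *\<^sub>v unit_vec (N * L) j = unit_vec (N * L) j"
    using grover_walk_M_pow_amplitude_vec[of L N \<phi> n] assms(1,2) \<phi> by simp
  then have "(?U *\<^sub>v unit_vec (N * L) j) $ i = unit_vec (N * L) j $ i" by simp
  moreover have "(?U *\<^sub>v unit_vec (N * L) j) $ i = ?U $$ (i, j)"
    using ij carrier_matD[OF carr] scalar_prod_right_unit[OF ij(2), of "row ?U i"]
    by (simp del: scalar_prod_right_unit)
  ultimately show "?U $$ (i, j) = 1\<^sub>m (N * L) $$ (i, j)"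
    using ij by simp
qed

subsection \<open>The cycle of length L\<close>

definition character :: "nat \<Rightarrow> int \<Rightarrow> complex" where
  "character L a = cis (2 * pi * of_int a / of_nat L)"

lemma character_0 [simp]: "character L 0 = 1"
  by (simp add: character_def)

lemma character_add: "character L (a + b) = character L a * character L b"
  by (simp add: character_def cis_mult ring_distribs add_divide_distrib)

lemma character_of_nat_mult: "character L (int k * a) = character L a ^ k"
  by (simp add: character_def DeMoivre mult_ac)

lemma character_eq_1_iff:
  assumes "L > 0"
  shows "character L a = 1 \<longleftrightarrow> int L dvd a"
proof
  assume "character L a = 1"
  then have "cos (2 * pi * of_int a / of_nat L) = 1"
    by (simp add: character_def complex_eq_iff)
  then obtain n :: int where "2 * pi * of_int a / of_nat L = of_int n * 2 * pi"
    by (auto simp: cos_one_2pi_int)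
  then have "real_of_int a = real_of_int (int L * n)"
    using assms by (simp add: field_simps)
  then show "int L dvd a" by (simp only: of_int_eq_iff) simp
next
  assume "int L dvd a"
  then obtain n where "a = int L * n" by auto
  then have "2 * pi * of_int a / of_nat L = 2 * pi * of_int n" using assms by simp
  then show "character L a = 1" by (simp add: character_def)
qed

lemma character_add_dvd:
  assumes "L > 0" "int L dvd b"
  shows "character L (a + b) = character L a"
  using assms by (simp add: character_add character_eq_1_iff)

text \<open>Orthogonality of the characters of Z/L: a geometric sum whose ratio
  \<open>character L a\<close> is an \<open>L\<close>-th root of unity.\<close>

lemma sum_character:
  assumes "L > 0"
  shows "(\<Sum>k<L. character L (int k * a)) = (if int L dvd a then of_nat L else 0)"
proof -
  have "character L a ^ L = 1"
    using assms by (simp flip: character_of_nat_mult add: character_eq_1_iff)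
  then show ?thesis
    using assms by (simp add: character_of_nat_mult sum_gp_strict character_eq_1_iff)
qed

text \<open>The Fourier mode with frequency \<open>k\<close> in position and \<open>l\<close> in the
  coin. Measuring the coin state by its displacement makes the shift replace \<open>l\<close> by
  \<open>l - k\<close> without any extra phase.\<close>

definition plane_wave :: "nat \<Rightarrow> int \<Rightarrow> int \<Rightarrow> int \<Rightarrow> nat \<Rightarrow> complex" where
  "plane_wave L k l x c = character L (k * x + l * displacement L c)"

definition coin_sign :: "nat \<Rightarrow> int \<Rightarrow> complex" where
  "coin_sign L l = (if int L dvd l then 1 else - 1)"

text \<open>If \<open>L\<close> divides \<open>l\<close>, the wave is constant in the coin variable
  and the coin contributes the factor \<open>2 - 1\<close>; otherwise the sum over the coin states
  vanishes and only the factor \<open>- 1\<close> is left.\<close>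

lemma walk_step_plane_wave:
  assumes "L > 0"
  shows "walk_step L (plane_wave L k l) = (\<lambda>x c. coin_sign L l * plane_wave L k (l - k) x c)"
proof (intro ext)
  fix x c
  define y where "y = x - displacement L c"
  have "(\<Sum>c'<L. plane_wave L k l y c')
      = (\<Sum>c'<L. character L (k * y - l * int (half L)) * character L (int c' * l))"
    by (intro sum.cong)
      (simp_all add: plane_wave_def displacement_def algebra_simps flip: character_add)
  also have "\<dots> = (if int L dvd l then of_nat L * character L (k * y) else 0)"
  proof -
    have "character L (k * y - l * int (half L)) = character L (k * y)" if "int L dvd l"
      using character_add_dvd[OF assms, of "- l * int (half L)" "k * y"] that by simp
    then show ?thesis using assms by (simp add: sum_character flip: sum_distrib_left)
  qed
  finally have sum: "(\<Sum>c'<L. plane_wave L k l y c')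
      = (if int L dvd l then of_nat L * character L (k * y) else 0)" .
  have wave: "plane_wave L k (l - k) x c = plane_wave L k l y c"
    by (simp add: plane_wave_def y_def algebra_simps)
  have "plane_wave L k l y c = character L (k * y)" if "int L dvd l"
    using character_add_dvd[OF assms, of "l * displacement L c" "k * y"] that
    by (simp add: plane_wave_def)
  then show "walk_step L (plane_wave L k l) x c = coin_sign L l * plane_wave L k (l - k) x c"
    using assms by (simp add: walk_step_def flip: y_def) (simp add: sum wave coin_sign_def)
qed

lemma walk_step_sum:
  "walk_step L (\<lambda>x c. \<Sum>i\<in>I. a i * \<phi> i x c) = (\<lambda>x c. \<Sum>i\<in>I. a i * walk_step L (\<phi> i) x c)"
proof (intro ext)
  fix x c
  show "walk_step L (\<lambda>x c. \<Sum>i\<in>I. a i * \<phi> i x c) x c = (\<Sum>i\<in>I. a i * walk_step L (\<phi> i) x c)"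
    unfolding walk_step_def
    by (subst sum.swap)
      (simp add: sum_distrib_left sum_distrib_right right_diff_distrib sum_subtractf mult_ac)
qed

lemma walk_step_scale:
  "walk_step L (\<lambda>x c. a * \<phi> x c) = (\<lambda>x c. a * walk_step L \<phi> x c)"
  using walk_step_sum[of L "\<lambda>_. a" "\<lambda>_. \<phi>" "{()}"] by simp

lemma walk_steps_sum:
  "(walk_step L ^^ n) (\<lambda>x c. \<Sum>i\<in>I. a i * \<phi> i x c)
   = (\<lambda>x c. \<Sum>i\<in>I. a i * (walk_step L ^^ n) (\<phi> i) x c)"
  by (induction n) (simp_all add: walk_step_sum)

lemma walk_steps_plane_wave:
  assumes "L > 0"
  shows "(walk_step L ^^ n) (plane_wave L k l)
    = (\<lambda>x c. (\<Prod>j<n. coin_sign L (l - int j * k)) * plane_wave L k (l - int n * k) x c)"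
proof (induction n)
  case (Suc n)
  have next_l: "l - int n * k - k = l - int (Suc n) * k" by (simp add: algebra_simps)
  show ?case
    by (simp only: funpow.simps o_apply Suc.IH walk_step_scale walk_step_plane_wave[OF assms]
        next_l prod.lessThan_Suc mult.assoc)
qed simp

lemma prod_lessThan_add:
  fixes f :: "nat \<Rightarrow> 'a::comm_monoid_mult"
  shows "(\<Prod>j<m + n. f j) = (\<Prod>j<m. f j) * (\<Prod>j<n. f (m + j))"
  by (induction n) (simp_all add: mult.assoc)

lemma plane_wave_fixed:
  assumes "L > 0"
  shows "(walk_step L ^^ (2 * L)) (plane_wave L k l) = plane_wave L k l"
proof -
  \<comment> \<open>The signs have period \<open>L\<close> in \<open>j\<close>, so in the product
    over \<open>2 * L\<close> steps the factors \<open>j\<close> and \<open>L + j\<close> agree and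
    cancel.\<close>
  have "coin_sign L (l - int (L + j) * k) = coin_sign L (l - int j * k)" for j
  proof -
    have "l - int (L + j) * k = (l - int j * k) + int L * - k" by (simp add: algebra_simps)
    then show ?thesis unfolding coin_sign_def by (metis dvd_add_times_triv_right_iff mult.commute)
  qed
  then have "(\<Prod>j<2 * L. coin_sign L (l - int j * k))
      = (\<Prod>j<L. coin_sign L (l - int j * k) * coin_sign L (l - int j * k))"
    by (simp add: mult_2 prod_lessThan_add prod.distrib)
  also have "\<dots> = 1"
    by (intro prod.neutral) (simp add: coin_sign_def)
  finally have prod: "(\<Prod>j<2 * L. coin_sign L (l - int j * k)) = 1" .
  have "plane_wave L k (l - int (2 * L) * k) x c = plane_wave L k l x c" for x c
  proof -
    have "k * x + (l - int (2 * L) * k) * displacement L c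
        = (k * x + l * displacement L c) + int L * (- 2 * k * displacement L c)"
      by (simp add: algebra_simps)
    then show ?thesis
      unfolding plane_wave_def using character_add_dvd[OF assms] by (metis dvd_triv_left)
  qed
  then show ?thesis
    unfolding walk_steps_plane_wave[OF assms] prod by simp
qed

lemma plane_wave_periodic:
  assumes "L > 0"
  shows "plane_wave L k l (x + int L) c = plane_wave L k l x c"
  using character_add_dvd[OF assms, of "k * int L" "k * x + l * displacement L c"]
  by (simp add: plane_wave_def algebra_simps)

section \<open>Fourier inversion and the period on the cycle of length L\<close>

text \<open>Fourier inversion in position and coin: the coefficient of a mode is the conjugate of
  its value at position \<open>a\<close> and coin state \<open>b\<close>, divided by
  \<open>L\<^sup>2\<close>.\<close>

lemma unit_amplitude_plane_waves:
  assumes "a < L" "b < L"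
  shows "amplitude_vec L L (\<lambda>x c. \<Sum>(k, l)\<in>{..<L} \<times> {..<L}.
      character L (- (int k * int a + int l * displacement L b)) / (of_nat L)\<^sup>2
        * plane_wave L (int k) (int l) x c)
    = unit_vec (L * L) (a * L + b)" (is "amplitude_vec L L ?\<phi> = _")
proof (rule eq_vecI)
  fix i assume "i < dim_vec (unit_vec (L * L) (a * L + b) :: complex vec)"
  then have i: "i < L * L" by simp
  have L: "L > 0" using assms by simp
  define x c where "x = i div L" and "c = i mod L"
  have xc: "x < L" "c < L" using i L by (auto simp: x_def c_def less_mult_imp_div_less)
  \<comment> \<open>Indices below \<open>L\<close> are congruent only when equal; this turns the
    orthogonality relation into a Kronecker delta.\<close>
  have small: "int L dvd int u - int v \<longleftrightarrow> u = v" if "u < L" "v < L" for u v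
    using that by (metis mod_eq_dvd_iff of_nat_eq_iff mod_less zmod_int)
  have "?\<phi> (int x) c = (\<Sum>k<L. \<Sum>l<L. character L (int k * (int x - int a))
      * character L (int l * (int c - int b)) / (of_nat L)\<^sup>2)"
    unfolding sum.cartesian_product
    by (intro sum.cong)
      (auto simp: plane_wave_def displacement_def algebra_simps simp flip: character_add)
  also have "\<dots> = (\<Sum>k<L. character L (int k * (int x - int a)))
      * (\<Sum>l<L. character L (int l * (int c - int b))) / (of_nat L)\<^sup>2"
    by (simp add: sum_product sum_divide_distrib)
  also have "\<dots> = (if x = a \<and> c = b then 1 else 0)"
    using L assms xc by (simp add: sum_character small power2_eq_square)
  also have "x = a \<and> c = b \<longleftrightarrow> i = a * L + b"
    using assms div_mult_mod_eq[of i L] by (auto simp: x_def c_def)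
  finally show "amplitude_vec L L ?\<phi> $ i = unit_vec (L * L) (a * L + b) $ i"
    using i index_less[OF assms] by (simp add: amplitude_vec_def unit_vec_def x_def c_def)
qed (simp add: amplitude_vec_def)

text \<open>Every basis vector is a superposition of plane waves, each fixed by \<open>2 * L\<close>
  steps, and the walk is linear.\<close>

lemma grover_walk_M_pow_twice:
  assumes "odd L"
  shows "grover_walk_M L L ^\<^sub>m (2 * L) = 1\<^sub>m (L * L)"
proof (rule grover_walk_M_pow_eq_oneI)
  have L: "L > 0" using assms by (cases L) auto
  then show "L > 0" .
  fix a b assume ab: "a < L" "b < L"
  define A where
    "A = (\<lambda>(k, l). character L (- (int k * int a + int l * displacement L b)) / (of_nat L)\<^sup>2)"
  define \<phi> where "\<phi> = (\<lambda>x c. \<Sum>i\<in>{..<L} \<times> {..<L}.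
      A i * plane_wave L (int (fst i)) (int (snd i)) x c)"
  have "amplitude_vec L L \<phi> = unit_vec (L * L) (a * L + b)"
    using unit_amplitude_plane_waves[OF ab] by (simp add: \<phi>_def A_def case_prod_unfold)
  moreover have "(walk_step L ^^ (2 * L)) \<phi> = \<phi>"
    unfolding \<phi>_def walk_steps_sum plane_wave_fixed[OF L] ..
  moreover have "\<phi> (x + int L) c = \<phi> x c" for x c
    by (simp add: \<phi>_def plane_wave_periodic[OF L])
  ultimately show "\<exists>\<phi>. (\<forall>x c. \<phi> (x + int L) c = \<phi> x c) \<and>
      (walk_step L ^^ (2 * L)) \<phi> = \<phi> \<and> amplitude_vec L L \<phi> = unit_vec (L * L) (a * L + b)"
    by blast
qed (rule assms)

lemma grover_walk_M_pow_eq_one_dvd: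
  assumes "L \<ge> 3" "odd L" and one: "grover_walk_M L L ^\<^sub>m n = 1\<^sub>m (L * L)"
  shows "2 * L dvd n"
proof -
  have L: "L > 0" using assms by simp
  \<comment> \<open>These coin indices have displacements 0 and 1; the second one lies in range
    because \<open>L \<ge> 3\<close>.\<close>
  have half: "half L < L" "half L + 1 < L"
    using assms by (auto simp: half_def elim!: oddE)
  have fixed: "(\<Prod>j<n. coin_sign L (l - int j * k)) * plane_wave L k (l - int n * k) x c
      = plane_wave L k l x c" if "c < L" for k l x c
    using grover_walk_M_pow_eq_oneD[where \<phi> = "plane_wave L k l" and x = x,
        OF assms(2) L plane_wave_periodic[OF L] one that]
    by (simp only: walk_steps_plane_wave[OF L])
  \<comment> \<open>The arguments of \<open>fixed\<close> are \<open>l\<close>, \<open>k\<close>,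
    \<open>x\<close> in this order. The mode \<open>k = 0\<close>, \<open>l = 1\<close> keeps its
    frequencies and changes sign at every step, since \<open>L\<close> does not divide 1.\<close>
  have "(- 1 :: complex) ^ n = 1"
    using fixed[OF half(1), of 1 0 0] assms(1) by (simp add: plane_wave_def coin_sign_def displacement_def)
  then have "even n" by (cases "even n") auto
  moreover have "int L dvd - int n"
  proof -
    \<comment> \<open>After \<open>n\<close> steps the mode \<open>k = 1\<close>,
      \<open>l = 0\<close> is a sign times the mode with \<open>l = - n\<close>. At
      \<open>x = 0\<close> and displacement 0 both waves are 1, which settles the sign; displacement
      1 then isolates \<open>character L (- int n)\<close>.\<close>
    have "(\<Prod>j<n. coin_sign L (- int j)) = 1"
      using fixed[OF half(1), of 0 1 0] by (simp add: plane_wave_def displacement_def)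
    then have "character L (- int n) = 1"
      using fixed[OF half(2), of 0 1 0] by (simp add: plane_wave_def displacement_def)
    then show ?thesis using character_eq_1_iff[OF L] by simp
  qed
  ultimately show ?thesis
    using assms(2) by (intro divides_mult) (auto simp: coprime_commute)
qed

subsection \<open>Cycles with a factor coprime to L\<close>

definition window :: "nat \<Rightarrow> (int \<Rightarrow> int) \<Rightarrow> int \<Rightarrow> int" where
  "window L f x = (\<Sum>c<L. f (x - displacement L c))"

lemma window_periodic:
  assumes "\<And>x. f (x + p) = f x"
  shows "window L f (x + p) = window L f x"
proof -
  have "f (x + p - d) = f (x - d)" for d
    using assms[of "x - d"] by (simp add: algebra_simps)
  then show ?thesis by (simp add: window_def)
qed

lemma windows_periodic:
  assumes "\<And>x. f (x + p) = f x"
  shows "(window L ^^ t) f (x + p) = (window L ^^ t) f x"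
  by (induction t arbitrary: x) (simp_all add: assms window_periodic)

text \<open>The sum of an \<open>n\<close>-periodic function over a full period is invariant under
  translation, and a window adds up \<open>L\<close> translates.\<close>

lemma sum_period_window:
  assumes "\<And>x. f (x + int n) = f x"
  shows "(\<Sum>x<n. window L f (int x)) = int L * (\<Sum>x<n. f (int x))"
proof -
  define F where "F a = (\<Sum>x<n. f (int x + a))" for a
  have "F (a + 1) = F a" for a
  proof -
    have "F (a + 1) + f a = (\<Sum>x<Suc n. f (int x + a))"
      by (subst sum.lessThan_Suc_shift) (simp add: F_def algebra_simps)
    then show ?thesis using assms[of a] by (simp add: F_def add.commute)
  qed
  then have F: "F a = F 0" for a
    using periodic_add_mult[of F 1 0 a] by simp
  have "(\<Sum>x<n. window L f (int x)) = (\<Sum>c<L. F (- displacement L c))"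
    unfolding window_def F_def by (subst sum.swap) simp
  also have "\<dots> = (\<Sum>c<L. F 0)"
    by (intro sum.cong refl F)
  finally show ?thesis by (simp add: F_def)
qed

text \<open>Neighbouring windows differ by \<open>g (x + int L) - g x\<close>, so modulo
  \<open>L\<close> the function has both periods \<open>L\<close> and \<open>n\<close>, hence by
  coprimality period 1.\<close>

lemma window_cong_0_imp_const:
  assumes per: "\<And>x. g (x + int n) = g x" and cop: "coprime n L"
    and win: "\<And>x. [window L g x = 0] (mod int L)"
  shows "[g x = g y] (mod int L)"
proof -
  have step: "[g (x + int L) = g x] (mod int L)" for x
  proof -
    \<comment> \<open>The window at \<open>?y\<close> covers \<open>x + 1\<close> to
      \<open>x + L\<close>, the one at \<open>?y - 1\<close> covers \<open>x\<close> to
      \<open>x + L - 1\<close>.\<close>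
    let ?y = "x + int L - int (half L)" and ?h = "\<lambda>c. g (x + int L - int c)"
    have "window L g ?y - window L g (?y - 1) = (\<Sum>c<L. ?h c - ?h (Suc c))"
      by (simp add: window_def displacement_def sum_subtractf algebra_simps)
    also have "\<dots> = g (x + int L) - g x"
      by (subst sum_lessThan_telescope') simp
    finally show ?thesis
      using cong_diff[OF win win, of ?y "?y - 1"] by (simp add: cong_iff_dvd_diff)
  qed
  obtain a b where ab: "a * int n + b * int L = 1"
    using bezout_int[of "int n" "int L"] cop by auto
  have "[g x = g 0] (mod int L)" for x
  proof -
    \<comment> \<open>The Bezout identity times \<open>x\<close>: the multiple of \<open>n\<close>
      is removed exactly, the multiple of \<open>L\<close> only modulo \<open>L\<close>.\<close>
    have "x = 0 + (x * b) * int L + (x * a) * int n"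
      using arg_cong[OF ab, of "\<lambda>z. x * z"] by (simp add: algebra_simps)
    then have "g x = g (0 + (x * b) * int L)"
      using periodic_add_mult[of g "int n", OF per] by metis
    moreover have "g (0 + (x * b) * int L) mod int L = g 0 mod int L"
      by (rule periodic_add_mult[of "\<lambda>z. g z mod int L"]) (use step in \<open>simp add: cong_def\<close>)
    ultimately show ?thesis by (simp add: cong_def)
  qed
  from this[of x] this[of y] show ?thesis by (simp add: cong_def)
qed

text \<open>The induction removes one window at a time and ends with a single one: concluding that
  the constant \<open>g\<close> vanishes modulo \<open>L\<close> uses that \<open>g\<close> is
  itself a window sum.\<close>

lemma windows_cong_0:
  assumes per: "\<And>x. f (x + int n) = f x" and cop: "coprime n L"
    and win: "\<And>x. [(window L ^^ Suc t) f x = 0] (mod int L)"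
  shows "[window L f x = 0] (mod int L)"
  using win
proof (induction t arbitrary: x)
  case (Suc t)
  define h where "h = (window L ^^ t) f"
  define g where "g = window L h"
  have h: "h (x + int n) = h x" for x
    unfolding h_def by (rule windows_periodic) (rule per)
  have g: "g (x + int n) = g x" for x
    unfolding g_def by (rule window_periodic) (rule h)
  have const: "[g x = g y] (mod int L)" for x y
    by (rule window_cong_0_imp_const[where g = g, OF g cop])
      (use Suc.prems in \<open>simp add: g_def h_def\<close>)
  \<comment> \<open>Over one period, \<open>g\<close> sums to \<open>n * g y\<close> by constancy
    and to a multiple of \<open>L\<close> by \<open>sum_period_window\<close>; \<open>n\<close> is
    invertible modulo \<open>L\<close>.\<close>
  have "[g y = 0] (mod int L)" for y
  proof -
    have "[(\<Sum>x<n. g (int x)) = (\<Sum>x<n. g y)] (mod int L)"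
      by (rule cong_sum) (rule const)
    moreover have "[(\<Sum>x<n. g (int x)) = 0] (mod int L)"
      unfolding g_def using sum_period_window[of h n L] h by (simp add: cong_0_iff)
    ultimately have "[int n * g y = 0] (mod int L)"
      by (simp add: cong_def)
    then show ?thesis
      using cop by (simp add: cong_0_iff coprime_dvd_mult_right_iff coprime_commute)
  qed
  then show ?case
    using Suc.IH[of x] by (simp add: g_def h_def)
qed simp

section \<open>The walk with denominators cleared\<close>

text \<open>\<open>L\<close> times \<open>walk_step\<close>, acting on integer amplitudes so that
  congruences modulo \<open>L\<close> make sense.\<close>

definition scaled_step :: "nat \<Rightarrow> (int \<Rightarrow> nat \<Rightarrow> int) \<Rightarrow> int \<Rightarrow> nat \<Rightarrow> int" where
  "scaled_step L \<psi> x c =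
     2 * (\<Sum>c'<L. \<psi> (x - displacement L c) c') - int L * \<psi> (x - displacement L c) c"

lemma walk_steps_of_int:
  assumes "L > 0"
  shows "of_nat L ^ t * (walk_step L ^^ t) (\<lambda>x c. of_int (\<psi> x c)) x c
         = of_int ((scaled_step L ^^ t) \<psi> x c)"
proof (induction t arbitrary: x c)
  case (Suc t)
  let ?y = "x - displacement L c"
  let ?\<phi> = "(walk_step L ^^ t) (\<lambda>x c. of_int (\<psi> x c))"
  have "of_nat L ^ Suc t * walk_step L ?\<phi> x c
      = 2 * (\<Sum>c'<L. of_nat L ^ t * ?\<phi> ?y c') - of_nat L * (of_nat L ^ t * ?\<phi> ?y c)"
    using assms by (simp add: walk_step_def right_diff_distrib flip: sum_distrib_left)
  also have "\<dots> = of_int (scaled_step L ((scaled_step L ^^ t) \<psi>) x c)"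
    by (simp add: Suc.IH scaled_step_def[of L "(scaled_step L ^^ t) \<psi>"])
  finally show ?case by simp
qed simp

text \<open>Modulo \<open>L\<close> the subtracted term disappears and a step sees only the coin
  sums, on which it acts as twice \<open>window\<close>.\<close>

lemma sum_scaled_steps_cong:
  "[(\<Sum>c<L. (scaled_step L ^^ t) \<psi> x c) = 2 ^ t * (window L ^^ t) (\<lambda>x. \<Sum>c<L. \<psi> x c) x]
   (mod int L)"
proof (induction t arbitrary: x)
  case (Suc t)
  let ?\<psi> = "(scaled_step L ^^ t) \<psi>" and ?f = "(window L ^^ t) (\<lambda>x. \<Sum>c<L. \<psi> x c)"
  have "(\<Sum>c<L. scaled_step L ?\<psi> x c)
      = 2 * (\<Sum>c<L. \<Sum>c'<L. ?\<psi> (x - displacement L c) c')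
        - int L * (\<Sum>c<L. ?\<psi> (x - displacement L c) c)"
    by (simp add: scaled_step_def[of L ?\<psi>] sum_subtractf sum_distrib_left)
  then have "[(\<Sum>c<L. scaled_step L ?\<psi> x c)
      = 2 * (\<Sum>c<L. \<Sum>c'<L. ?\<psi> (x - displacement L c) c')] (mod int L)"
    by (simp add: cong_iff_dvd_diff)
  also have "[2 * (\<Sum>c<L. \<Sum>c'<L. ?\<psi> (x - displacement L c) c')
      = 2 * (\<Sum>c<L. 2 ^ t * ?f (x - displacement L c))] (mod int L)"
    by (intro cong_scalar_left cong_sum Suc.IH)
  also have "2 * (\<Sum>c<L. 2 ^ t * ?f (x - displacement L c)) = 2 ^ Suc t * window L ?f x"
    by (simp add: window_def[of L ?f] sum_distrib_left mult.assoc)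
  finally show ?case by simp
qed simp

lemma grover_walk_M_pow_neq_one:
  assumes "L \<ge> 3" "odd L" "N \<ge> 2" "n \<ge> 2" "n dvd N" "coprime n L" "t \<ge> 1"
  shows "grover_walk_M N L ^\<^sub>m t \<noteq> 1\<^sub>m (N * L)"
proof
  assume one: "grover_walk_M N L ^\<^sub>m t = 1\<^sub>m (N * L)"
  have L: "L > 0" and N: "N > 0" using assms by simp_all
  obtain r where t: "t = Suc r" using assms(7) by (cases t) auto
  define f :: "int \<Rightarrow> int" where "f x = (if int n dvd x then 1 else 0)" for x
  have fn: "f (x + int n) = f x" for x by (simp add: f_def)
  have fN: "f (x + int N) = f x" for x
    using assms(5) by (simp add: f_def dvd_add_left_iff)
  \<comment> \<open>Placing \<open>f\<close> in a single coin state makes the coin sums equal to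
    \<open>f\<close>.\<close>
  define \<psi> where "\<psi> x c = (if c = 0 then f x else 0)" for x and c :: nat
  have sum: "(\<Sum>c<L. \<psi> x c) = f x" for x
    using L by (simp add: \<psi>_def)
  have fixed: "(scaled_step L ^^ t) \<psi> x c = int L ^ t * \<psi> x c" if "c < L" for x c
  proof -
    have "(walk_step L ^^ t) (\<lambda>x c. of_int (\<psi> x c)) x c = of_int (\<psi> x c)"
      by (rule grover_walk_M_pow_eq_oneD[OF assms(2) N _ one that]) (simp add: \<psi>_def fN)
    then have "(of_int ((scaled_step L ^^ t) \<psi> x c) :: complex) = of_int (int L ^ t * \<psi> x c)"
      using walk_steps_of_int[OF L, of t \<psi> x c] by simp
    then show ?thesis by (simp only: of_int_eq_iff)
  qed
  have "[(window L ^^ Suc r) f x = 0] (mod int L)" for x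
  proof -
    have "(\<Sum>c<L. (scaled_step L ^^ t) \<psi> x c) = int L ^ t * f x"
      by (simp add: fixed sum flip: sum_distrib_left)
    then have "[2 ^ t * (window L ^^ t) f x = int L ^ t * f x] (mod int L)"
      using sum_scaled_steps_cong[where L = L and t = t and \<psi> = \<psi> and x = x] by (simp add: sum cong_sym_eq)
    \<comment> \<open>Since \<open>t\<close> is a successor, \<open>int L ^ t\<close> contains a
      factor \<open>L\<close>; the power of 2 is then cancelled because \<open>L\<close> is
      odd.\<close>
    then have "int L dvd 2 ^ t * (window L ^^ t) f x"
      by (auto simp: t cong_dvd_iff)
    moreover have "coprime (int L) (2 ^ t)"
      using assms(2) by (simp add: coprime_commute)
    ultimately show ?thesis
      by (simp add: cong_0_iff coprime_dvd_mult_right_iff t)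
  qed
  then have "[window L f x = 0] (mod int L)" for x
    using windows_cong_0[of f n L r] fn assms(6) by blast
  \<comment> \<open>As \<open>n \<ge> 2\<close>, these values are 1 and 0, which are incongruent
    modulo \<open>L \<ge> 3\<close>.\<close>
  then have "[f 0 = f 1] (mod int L)"
    using window_cong_0_imp_const[of f n L 0 1] fn assms(6) by blast
  then show False
    using assms(1,4) by (auto simp: f_def cong_0_iff cong_sym_eq)
qed

theorem theorem4p2:
  fixes L :: nat
  assumes "L \<ge> 3" and "odd L"
  shows "period_M L L = enat (2 * L) \<and>
         (\<forall>N\<ge>2. (\<exists>n\<ge>2. n dvd N \<and> coprime n L) \<longrightarrow> period_M N L = \<infinity>)"
proof (intro conjI allI impI)
  show "period_M L L = enat (2 * L)"
    unfolding period_M_def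
  \<comment> \<open>The infimum is attained: \<open>2 * L\<close> is in the set and divides each of
    its positive members.\<close>
  proof (rule antisym[OF Inf_lower Inf_greatest])
    show "enat (2 * L) \<in> enat ` {n. n \<ge> 1 \<and> grover_walk_M L L ^\<^sub>m n = 1\<^sub>m (L * L)}"
      using assms grover_walk_M_pow_twice by (intro imageI) simp
  next
    fix y assume "y \<in> enat ` {n. n \<ge> 1 \<and> grover_walk_M L L ^\<^sub>m n = 1\<^sub>m (L * L)}"
    then obtain n where "y = enat n" "n \<ge> 1" "2 * L dvd n"
      using grover_walk_M_pow_eq_one_dvd[OF assms] by blast
    then show "enat (2 * L) \<le> y"
      by (simp add: dvd_imp_le)
  qed
next
  fix N :: nat assume "N \<ge> 2" "\<exists>n\<ge>2. n dvd N \<and> coprime n L"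
  then have "{n. n \<ge> 1 \<and> grover_walk_M N L ^\<^sub>m n = 1\<^sub>m (N * L)} = {}"
    using grover_walk_M_pow_neq_one[OF assms] by blast
  then show "period_M N L = \<infinity>"
    by (simp only: period_M_def image_empty Inf_empty top_enat_def)
qed

end
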